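(* Let $(G,X,\Gamma)$ be a $(\mu,\nu)$-path system group. Assume that $G$ contains a constricting element. Let $H$ be an infinite index quasi-convex subgroup of $G$. Then $\omega_{G/H}=\omega_{H\backslash G}=\omega_G$.
   Context: A path in a metric space $X$ is a rectifiable continuous map $\alpha\colon[a,b]\to X$ parametrised by arc length; it is a $(\kappa,\lambda)$-quasi-geodesic if $d(\alpha(t),\alpha(t'))\le |t-t'|\le \kappa\, d(\alpha(t),\alpha(t'))+\lambda$ for all $t,t'$. $Y^{+\eta}=\{x: d(x,Y)\le\eta\}$. A $(\mu,\nu)$-path system on a geodesic metric space $X$ is a collection $\Gamma$ of paths closed under subpaths, such that any two points are joined by an element of $\Gamma$ and every element of $\Gamma$ is a $(\mu,\nu)$-quasi-geodesic. A $(\mu,\nu)$-path system group $(G,X,\Gamma)$ is a group $G$ acting properly by isometries on a geodesic metric space $X$ (balls $B_G(x,r)=\{g\in G: d(x,gx)\le r\}$ finite) with $\Gamma$ a $G$-invariant $(\mu,\nu)$-path system. A subset $Y$ is $\eta$-quasi-convex if every $\gamma\in\Gamma$ with endpoints in $Y$ lies in $Y^{+\eta}$. A subgroup $H$ is quasi-convex if for some $\eta\ge0$ there is an $H$-invariant $\eta$-quasi-convex $Y\subseteq X$ on which $H$ acts $\eta$-coboundedly (for all $y,y'\in Y$ there is $h\in H$ with $d(y,hy')\le\eta$). A subset $A$ is $\delta$-constricting if there is $\pi_A\colon X\to A$ with (CS1) $d(x,\pi_A(x))\le\delta$ for $x\in A$, and (CS2) for all $x,y\in X$ and $\gamma\in\Gamma$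 joining them, if $d(\pi_A(x),\pi_A(y))>\delta$ then $\gamma$ meets $B_X(\pi_A(x),\delta)$ and $B_X(\pi_A(y),\delta)$. An element $g$ is constricting if it has infinite order and for some $\delta$ there is a $\langle g\rangle$-invariant $\delta$-constricting $A$ on which $\langle g\rangle$ acts $\delta$-coboundedly. For $o\in X$: $\omega_G=\limsup_{r\to\infty}\frac1r\log|B_G(o,r)|$, $\omega_{G/H}=\limsup_{r\to\infty}\frac1r\log|\mathcal L(B_G(o,r))|$ and $\omega_{H\backslash G}=\limsup_{r\to\infty}\frac1r\log|\mathcal R(B_G(o,r))|$, where $\mathcal L\colon G\to G/H$ and $\mathcal R\colon G\to H\backslash G$ are the natural maps to left and right cosets. *)

theory Defs
  imports "HOL-Analysis.Analysis" "HOL-Algebra.Coset" "HOL-Algebra.Generated_Groups"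
begin

definition geodesic_space :: "'x::metric_space itself \<Rightarrow> bool" where
  "geodesic_space _ \<longleftrightarrow> (\<forall>x y::'x. \<exists>c::real \<Rightarrow> 'x. c 0 = x \<and> c (dist x y) = y \<and>
     (\<forall>s\<in>{0..dist x y}. \<forall>t\<in>{0..dist x y}. dist (c s) (c t) = \<bar>s - t\<bar>))"

fun chain_len :: "(real \<Rightarrow> 'x::metric_space) \<Rightarrow> real list \<Rightarrow> real" where
  "chain_len \<alpha> (u # v # ps) = dist (\<alpha> u) (\<alpha> v) + chain_len \<alpha> (v # ps)"
| "chain_len \<alpha> _ = 0"

definition curve_length :: "(real \<Rightarrow> 'x::metric_space) \<Rightarrow> real \<Rightarrow> real \<Rightarrow> ereal" where
  "curve_length \<alpha> s t = (SUP ps \<in> {ps. sorted ps \<and> ps \<noteq> [] \<and> hd ps = s \<and> last ps = t}.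
                           ereal (chain_len \<alpha> ps))"

text \<open>A path is encoded as a triple (a, b, alpha) standing for alpha restricted to [a,b].\<close>
type_synonym 'x path = "real \<times> real \<times> (real \<Rightarrow> 'x)"

definition is_path :: "'x::metric_space path \<Rightarrow> bool" where
  "is_path p \<longleftrightarrow> (case p of (a, b, \<alpha>) \<Rightarrow> a \<le> b \<and> continuous_on {a..b} \<alpha> \<and>
      (\<forall>s t. a \<le> s \<and> s \<le> t \<and> t \<le> b \<longrightarrow> curve_length \<alpha> s t = ereal (t - s)))"

definition quasi_geodesic :: "real \<Rightarrow> real \<Rightarrow> 'x::metric_space path \<Rightarrow> bool" where
  "quasi_geodesic k l p \<longleftrightarrow> is_path p \<and> (case p of (a, b, \<alpha>) \<Rightarrow>
      (\<forall>t\<in>{a..b}. \<forall>t'\<in>{a..b}. dist (\<alpha> t) (\<alpha> t') \<le> \<bar>t - t'\<bar> \<and>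
                                \<bar>t - t'\<bar> \<le> k * dist (\<alpha> t) (\<alpha> t') + l))"

definition path_image' :: "'x path \<Rightarrow> 'x set" where
  "path_image' p = (case p of (a, b, \<alpha>) \<Rightarrow> \<alpha> ` {a..b})"

definition start_pt :: "'x path \<Rightarrow> 'x" where
  "start_pt p = (case p of (a, b, \<alpha>) \<Rightarrow> \<alpha> a)"

definition end_pt :: "'x path \<Rightarrow> 'x" where
  "end_pt p = (case p of (a, b, \<alpha>) \<Rightarrow> \<alpha> b)"

definition nbhd :: "'x::metric_space set \<Rightarrow> real \<Rightarrow> 'x set" where
  "nbhd Y \<eta> = {x. infdist x Y \<le> \<eta>}"

definition path_system :: "real \<Rightarrow> real \<Rightarrow> 'x::metric_space path set \<Rightarrow> bool" where
  "path_system \<mu> \<nu> \<Gamma> \<longleftrightarrow>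
     (\<forall>p\<in>\<Gamma>. is_path p) \<and>
     (\<forall>a b \<alpha> a' b'. (a, b, \<alpha>) \<in> \<Gamma> \<and> a \<le> a' \<and> a' \<le> b' \<and> b' \<le> b \<longrightarrow> (a', b', \<alpha>) \<in> \<Gamma>) \<and>
     (\<forall>x y. \<exists>p\<in>\<Gamma>. start_pt p = x \<and> end_pt p = y) \<and>
     (\<forall>p\<in>\<Gamma>. quasi_geodesic \<mu> \<nu> p)"

definition isometric_action :: "('g, 'b) monoid_scheme \<Rightarrow> ('g \<Rightarrow> 'x::metric_space \<Rightarrow> 'x) \<Rightarrow> bool" where
  "isometric_action G \<phi> \<longleftrightarrow> group G \<and>
     (\<forall>x. \<phi> \<one>\<^bsub>G\<^esub> x = x) \<and>
     (\<forall>g\<in>carrier G. \<forall>h\<in>carrier G. \<forall>x. \<phi> (g \<otimes>\<^bsub>G\<^esub> h) x = \<phi> g (\<phi> h x)) \<and>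
     (\<forall>g\<in>carrier G. \<forall>x y. dist (\<phi> g x) (\<phi> g y) = dist x y)"

definition gball :: "('g, 'b) monoid_scheme \<Rightarrow> ('g \<Rightarrow> 'x::metric_space \<Rightarrow> 'x) \<Rightarrow> 'x \<Rightarrow> real \<Rightarrow> 'g set" where
  "gball G \<phi> x r = {g \<in> carrier G. dist x (\<phi> g x) \<le> r}"

definition proper_action :: "('g, 'b) monoid_scheme \<Rightarrow> ('g \<Rightarrow> 'x::metric_space \<Rightarrow> 'x) \<Rightarrow> bool" where
  "proper_action G \<phi> \<longleftrightarrow> (\<forall>x r. finite (gball G \<phi> x r))"

definition path_system_group ::
  "('g, 'b) monoid_scheme \<Rightarrow> ('g \<Rightarrow> 'x::metric_space \<Rightarrow> 'x) \<Rightarrow> 'x path set \<Rightarrow> real \<Rightarrow> real \<Rightarrow> bool" where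
  "path_system_group G \<phi> \<Gamma> \<mu> \<nu> \<longleftrightarrow>
     geodesic_space TYPE('x) \<and> isometric_action G \<phi> \<and> proper_action G \<phi> \<and>
     path_system \<mu> \<nu> \<Gamma> \<and>
     (\<forall>g\<in>carrier G. \<forall>a b \<alpha>. (a, b, \<alpha>) \<in> \<Gamma> \<longrightarrow> (a, b, \<phi> g \<circ> \<alpha>) \<in> \<Gamma>)"

definition invariant_set :: "'g set \<Rightarrow> ('g \<Rightarrow> 'x \<Rightarrow> 'x) \<Rightarrow> 'x set \<Rightarrow> bool" where
  "invariant_set H \<phi> Y \<longleftrightarrow> (\<forall>h\<in>H. \<phi> h ` Y \<subseteq> Y)"

definition acts_coboundedly :: "'g set \<Rightarrow> ('g \<Rightarrow> 'x::metric_space \<Rightarrow> 'x) \<Rightarrow> 'x set \<Rightarrow> real \<Rightarrow> bool" where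
  "acts_coboundedly H \<phi> Y \<eta> \<longleftrightarrow> (\<forall>y\<in>Y. \<forall>y'\<in>Y. \<exists>h\<in>H. dist y (\<phi> h y') \<le> \<eta>)"

definition quasi_convex_set :: "'x::metric_space path set \<Rightarrow> real \<Rightarrow> 'x set \<Rightarrow> bool" where
  "quasi_convex_set \<Gamma> \<eta> Y \<longleftrightarrow>
     (\<forall>p\<in>\<Gamma>. start_pt p \<in> Y \<and> end_pt p \<in> Y \<longrightarrow> path_image' p \<subseteq> nbhd Y \<eta>)"

definition quasi_convex_subgroup ::
  "('g, 'b) monoid_scheme \<Rightarrow> ('g \<Rightarrow> 'x::metric_space \<Rightarrow> 'x) \<Rightarrow> 'x path set \<Rightarrow> 'g set \<Rightarrow> bool" where
  "quasi_convex_subgroup G \<phi> \<Gamma> H \<longleftrightarrow> subgroup H G \<and>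
     (\<exists>\<eta>\<ge>0. \<exists>Y. Y \<noteq> {} \<and> invariant_set H \<phi> Y \<and> quasi_convex_set \<Gamma> \<eta> Y \<and>
                  acts_coboundedly H \<phi> Y \<eta>)"

definition constricting_set :: "'x::metric_space path set \<Rightarrow> real \<Rightarrow> 'x set \<Rightarrow> bool" where
  "constricting_set \<Gamma> \<delta> A \<longleftrightarrow> (\<exists>\<pi>. (\<forall>x. \<pi> x \<in> A) \<and>
     (\<forall>x\<in>A. dist x (\<pi> x) \<le> \<delta>) \<and>
     (\<forall>x y. \<forall>p\<in>\<Gamma>. start_pt p = x \<and> end_pt p = y \<and> dist (\<pi> x) (\<pi> y) > \<delta> \<longrightarrow>
         path_image' p \<inter> cball (\<pi> x) \<delta> \<noteq> {} \<and> path_image' p \<inter> cball (\<pi> y) \<delta> \<noteq> {}))"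

definition constricting_element ::
  "('g, 'b) monoid_scheme \<Rightarrow> ('g \<Rightarrow> 'x::metric_space \<Rightarrow> 'x) \<Rightarrow> 'x path set \<Rightarrow> 'g \<Rightarrow> bool" where
  "constricting_element G \<phi> \<Gamma> g \<longleftrightarrow> g \<in> carrier G \<and>
     (\<forall>n::nat. n > 0 \<longrightarrow> g [^]\<^bsub>G\<^esub> n \<noteq> \<one>\<^bsub>G\<^esub>) \<and>
     (\<exists>\<delta> A. invariant_set (generate G {g}) \<phi> A \<and> constricting_set \<Gamma> \<delta> A \<and>
            acts_coboundedly (generate G {g}) \<phi> A \<delta>)"

definition growth_rate :: "(real \<Rightarrow> nat) \<Rightarrow> ereal" where
  "growth_rate N = Limsup at_top (\<lambda>r::real. ereal (ln (real (N r)) / r))"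

definition omega_G :: "('g, 'b) monoid_scheme \<Rightarrow> ('g \<Rightarrow> 'x::metric_space \<Rightarrow> 'x) \<Rightarrow> 'x \<Rightarrow> ereal" where
  "omega_G G \<phi> x0 = growth_rate (\<lambda>r. card (gball G \<phi> x0 r))"

definition omega_left ::
  "('g, 'b) monoid_scheme \<Rightarrow> ('g \<Rightarrow> 'x::metric_space \<Rightarrow> 'x) \<Rightarrow> 'g set \<Rightarrow> 'x \<Rightarrow> ereal" where
  "omega_left G \<phi> H x0 = growth_rate (\<lambda>r. card ((\<lambda>g. l_coset G g H) ` gball G \<phi> x0 r))"

definition omega_right ::
  "('g, 'b) monoid_scheme \<Rightarrow> ('g \<Rightarrow> 'x::metric_space \<Rightarrow> 'x) \<Rightarrow> 'g set \<Rightarrow> 'x \<Rightarrow> ereal" where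
  "omega_right G \<phi> H x0 = growth_rate (\<lambda>r. card ((\<lambda>g. r_coset G H g) ` gball G \<phi> x0 r))"

end

theory Submission
  imports Defs "HOL-Algebra.Multiplicative_Group"
begin

text \<open>
  Inversion identifies left and right cosets meeting a ball, so only right cosets matter. They are
  counted through a region \<open>Z \<subseteq> X\<close> that meets only finitely many of its \<open>H\<close>-translates: on the
  \<open>g\<close> sending the base point into \<open>Z\<close>, the map \<open>g \<mapsto> Hg\<close> is uniformly finite-to-one. If moreover
  finitely many translates of \<open>Z\<close> cover \<open>X\<close>, then up to a constant and a shift of the radius these
  \<open>g\<close> exhaust \<open>G\<close>.

  Let \<open>f\<close> be constricting with axis \<open>A\<close> and let \<open>H\<close> act coboundedly on the quasi-convex set \<open>Y\<close>.
  Some translate \<open>wA\<close> has bounded projection of \<open>Y\<close>: otherwise there is a finite set \<open>F\<close> such that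
  for every \<open>w\<close> infinitely many \<open>k\<close> satisfy \<open>w f\<^sup>k \<in> HF\<close>, so that the orbit of \<open>Hw\<close> under \<open>\<langle>f\<rangle>\<close> is
  finite and one of finitely many orbits, and \<open>H\<close> has finite index.

  Let \<open>Z\<close> consist of the points whose projection to \<open>wA\<close> is far from that of \<open>Y\<close>. If \<open>z\<close> and \<open>h\<^sup>-\<^sup>1z\<close>
  both lie in \<open>Z\<close>, a path from \<open>y \<in> Y\<close> to \<open>z\<close> passes near \<open>hy\<close>, and as it cannot backtrack, \<open>hy\<close> is
  near \<open>y\<close>; so there are finitely many such \<open>h \<in> H\<close>. A large power of \<open>f\<close> moves the complement of
  \<open>w\<^sup>-\<^sup>1Z\<close> into \<open>w\<^sup>-\<^sup>1Z\<close>, so two translates of \<open>Z\<close> cover \<open>X\<close>.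
\<close>

section \<open>Constricting projections\<close>

lemma dist_triangle4:
  fixes a b c d :: "'a::metric_space"
  shows "dist a d \<le> dist a b + dist b c + dist c d"
  using dist_triangle[of a d b] dist_triangle[of b d c] by linarith

definition constricting_projection ::
  "'x::metric_space path set \<Rightarrow> real \<Rightarrow> 'x set \<Rightarrow> ('x \<Rightarrow> 'x) \<Rightarrow> bool" where
  "constricting_projection \<Gamma> \<delta> A \<pi> \<longleftrightarrow> range \<pi> \<subseteq> A \<and> (\<forall>x\<in>A. dist x (\<pi> x) \<le> \<delta>) \<and>
     (\<forall>a b \<alpha>. (a, b, \<alpha>) \<in> \<Gamma> \<longrightarrow> dist (\<pi> (\<alpha> a)) (\<pi> (\<alpha> b)) > \<delta> \<longrightarrow>
        (\<exists>t\<in>{a..b}. dist (\<pi> (\<alpha> a)) (\<alpha> t) \<le> \<delta>) \<and> (\<exists>t\<in>{a..b}. dist (\<pi> (\<alpha> b)) (\<alpha> t) \<le> \<delta>))"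

lemma constricting_set_iff_projection:
  "constricting_set \<Gamma> \<delta> A \<longleftrightarrow> (\<exists>\<pi>. constricting_projection \<Gamma> \<delta> A \<pi>)"
proof -
  have meets_cball: "path_image' (a, b, \<alpha>) \<inter> cball c \<delta> \<noteq> {} \<longleftrightarrow> (\<exists>t\<in>{a..b}. dist c (\<alpha> t) \<le> \<delta>)"
    for a b \<alpha> and c :: 'a
    by (auto simp: path_image'_def)
  show ?thesis
    unfolding constricting_set_def constricting_projection_def Ball_def[of \<Gamma>] split_paired_All
      meets_cball start_pt_def end_pt_def
    by (rule ex_cong1) (auto simp: image_subset_iff)
qed

lemma constricting_projection_in:
  "constricting_projection \<Gamma> \<delta> A \<pi> \<Longrightarrow> \<pi> x \<in> A"
  by (auto simp: constricting_projection_def)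

lemma constricting_projection_moves_le:
  "constricting_projection \<Gamma> \<delta> A \<pi> \<Longrightarrow> x \<in> A \<Longrightarrow> dist x (\<pi> x) \<le> \<delta>"
  by (auto simp: constricting_projection_def)

lemma constricting_projection_nonneg:
  assumes "constricting_projection \<Gamma> \<delta> A \<pi>"
  shows "0 \<le> \<delta>"
  using constricting_projection_moves_le[OF assms constricting_projection_in[OF assms]]
  by (meson order_trans zero_le_dist)

lemma path_system_mono:
  assumes "path_system \<mu> \<nu> \<Gamma>" "\<mu> \<le> \<mu>'" "\<nu> \<le> \<nu>'"
  shows "path_system \<mu>' \<nu>' \<Gamma>"
proof -
  have "quasi_geodesic \<mu>' \<nu>' (a, b, \<alpha>)" if "quasi_geodesic \<mu> \<nu> (a, b, \<alpha>)"
    for a b and \<alpha> :: "real \<Rightarrow> 'a"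
  proof -
    have "\<mu> * dist x y + \<nu> \<le> \<mu>' * dist x y + \<nu>'" for x y :: 'a
      using assms(2,3) by (intro add_mono mult_right_mono) auto
    with that show ?thesis unfolding quasi_geodesic_def prod.case by (meson order_trans)
  qed
  with assms(1) show ?thesis unfolding path_system_def by (metis prod_cases3)
qed

locale path_space =
  fixes \<Gamma> :: "'x::metric_space path set" and \<mu> \<nu> :: real
  assumes path_system: "path_system \<mu> \<nu> \<Gamma>"
    and nonneg: "0 \<le> \<mu>" "0 \<le> \<nu>"
begin

lemma joining_path:
  obtains a b \<alpha> where "(a, b, \<alpha>) \<in> \<Gamma>" "a \<le> b" "\<alpha> a = x" "\<alpha> b = y"
proof -
  obtain p where p: "p \<in> \<Gamma>" "start_pt p = x" "end_pt p = y" "is_path p"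
    using path_system unfolding path_system_def by metis
  obtain a b \<alpha> where "p = (a, b, \<alpha>)" by (cases p)
  with p that show thesis
    by (auto simp: start_pt_def end_pt_def is_path_def)
qed

lemma path_quasi_geodesic:
  assumes "(a, b, \<alpha>) \<in> \<Gamma>" "s \<in> {a..b}" "t \<in> {a..b}"
  shows "dist (\<alpha> s) (\<alpha> t) \<le> \<bar>s - t\<bar>" "\<bar>s - t\<bar> \<le> \<mu> * dist (\<alpha> s) (\<alpha> t) + \<nu>"
proof -
  have "quasi_geodesic \<mu> \<nu> (a, b, \<alpha>)"
    using path_system assms(1) unfolding path_system_def by blast
  with assms(2,3) show "dist (\<alpha> s) (\<alpha> t) \<le> \<bar>s - t\<bar>" "\<bar>s - t\<bar> \<le> \<mu> * dist (\<alpha> s) (\<alpha> t) + \<nu>"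
    unfolding quasi_geodesic_def prod.case by blast+
qed

lemma subpath_diameter_le:
  assumes path: "(a, b, \<alpha>) \<in> \<Gamma>" and ends: "p \<in> {a..b}" "q \<in> {a..b}"
    and between: "s \<in> {p..q}" "t \<in> {p..q}"
  shows "dist (\<alpha> s) (\<alpha> t) \<le> \<mu> * dist (\<alpha> p) (\<alpha> q) + \<nu>"
proof -
  have "dist (\<alpha> s) (\<alpha> t) \<le> \<bar>s - t\<bar>"
    using ends between by (intro path_quasi_geodesic(1)[OF path]) auto
  also have "\<dots> \<le> \<bar>p - q\<bar>" using between by auto
  also have "\<dots> \<le> \<mu> * dist (\<alpha> p) (\<alpha> q) + \<nu>" by (rule path_quasi_geodesic(2)[OF path ends])
  finally show ?thesis .
qed

lemma subpath_meets_balls: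
  assumes \<pi>: "constricting_projection \<Gamma> \<delta> A \<pi>" and path: "(a, b, \<alpha>) \<in> \<Gamma>"
    and params: "a \<le> s" "s \<le> t" "t \<le> b" and far: "dist (\<pi> (\<alpha> s)) (\<pi> (\<alpha> t)) > \<delta>"
  shows "\<exists>r\<in>{s..t}. dist (\<pi> (\<alpha> s)) (\<alpha> r) \<le> \<delta>" "\<exists>r\<in>{s..t}. dist (\<pi> (\<alpha> t)) (\<alpha> r) \<le> \<delta>"
proof -
  have "(s, t, \<alpha>) \<in> \<Gamma>"
    using path_system path params unfolding path_system_def by metis
  with \<pi> far show "\<exists>r\<in>{s..t}. dist (\<pi> (\<alpha> s)) (\<alpha> r) \<le> \<delta>" "\<exists>r\<in>{s..t}. dist (\<pi> (\<alpha> t)) (\<alpha> r) \<le> \<delta>"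
    unfolding constricting_projection_def by blast+
qed

lemma projection_coarse_lipschitz:
  assumes \<pi>: "constricting_projection \<Gamma> \<delta> A \<pi>"
  shows "dist (\<pi> x) (\<pi> y) \<le> \<mu> * dist x y + \<nu> + 2 * \<delta>"
proof (cases "dist (\<pi> x) (\<pi> y) > \<delta>")
  case True
  obtain a b \<alpha> where path: "(a, b, \<alpha>) \<in> \<Gamma>" "a \<le> b" "\<alpha> a = x" "\<alpha> b = y"
    by (rule joining_path)
  obtain s t where st: "s \<in> {a..b}" "dist (\<pi> x) (\<alpha> s) \<le> \<delta>" "t \<in> {a..b}" "dist (\<pi> y) (\<alpha> t) \<le> \<delta>"
    using subpath_meets_balls[OF \<pi> path(1), of a b] path True by auto
  have "dist (\<alpha> s) (\<alpha> t) \<le> \<mu> * dist x y + \<nu>"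
    using subpath_diameter_le[OF path(1), of a b s t] path st by auto
  moreover have "dist (\<pi> x) (\<pi> y) \<le> dist (\<pi> x) (\<alpha> s) + dist (\<alpha> s) (\<alpha> t) + dist (\<pi> y) (\<alpha> t)"
    using dist_triangle4 by (metis dist_commute)
  ultimately show ?thesis using st by linarith
next
  case False
  moreover have "0 \<le> \<mu> * dist x y" using nonneg by simp
  ultimately show ?thesis
    using nonneg constricting_projection_nonneg[OF \<pi>] by linarith
qed

definition near_bound :: "real \<Rightarrow> real \<Rightarrow> real" where
  "near_bound \<delta> r = \<mu> * r + \<nu> + 3 * \<delta>"

lemma near_bound_ge: "0 \<le> \<delta> \<Longrightarrow> 0 \<le> r \<Longrightarrow> \<delta> \<le> near_bound \<delta> r"
  using nonneg by (simp add: near_bound_def add_increasing)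

lemma projection_near:
  assumes \<pi>: "constricting_projection \<Gamma> \<delta> A \<pi>" and c: "c \<in> A" and near: "dist x c \<le> r"
  shows "dist (\<pi> x) c \<le> near_bound \<delta> r"
proof -
  have "dist (\<pi> x) (\<pi> c) \<le> \<mu> * dist x c + \<nu> + 2 * \<delta>"
    by (rule projection_coarse_lipschitz[OF \<pi>])
  moreover have "\<mu> * dist x c \<le> \<mu> * r"
    using near nonneg by (intro mult_left_mono)
  moreover have "dist c (\<pi> c) \<le> \<delta>" by (rule constricting_projection_moves_le[OF \<pi> c])
  moreover have "dist (\<pi> x) c \<le> dist (\<pi> x) (\<pi> c) + dist c (\<pi> c)" by (rule dist_triangle2)
  ultimately show ?thesis unfolding near_bound_def by linarith
qed

lemma projection_coarsely_constant_towards_projection: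
  assumes \<pi>: "constricting_projection \<Gamma> \<delta> A \<pi>"
    and path: "(a, b, \<alpha>) \<in> \<Gamma>" "\<alpha> b = \<pi> (\<alpha> a)" and t: "t \<in> {a..b}"
  shows "dist (\<pi> (\<alpha> a)) (\<pi> (\<alpha> t)) \<le> near_bound \<delta> (\<mu> * \<delta> + \<nu>)"
proof (cases "dist (\<pi> (\<alpha> a)) (\<pi> (\<alpha> t)) > \<delta>")
  case True
  then obtain s where s: "s \<in> {a..t}" "dist (\<alpha> b) (\<alpha> s) \<le> \<delta>"
    using subpath_meets_balls(1)[OF \<pi> path(1), of a t] t path(2) by auto
  have "dist (\<alpha> t) (\<alpha> b) \<le> \<mu> * dist (\<alpha> s) (\<alpha> b) + \<nu>"
    using s t by (intro subpath_diameter_le[OF path(1)]) auto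
  also have "\<dots> \<le> \<mu> * \<delta> + \<nu>" using s nonneg by (simp add: dist_commute mult_left_mono)
  finally have "dist (\<pi> (\<alpha> t)) (\<alpha> b) \<le> near_bound \<delta> (\<mu> * \<delta> + \<nu>)"
    using path(2) constricting_projection_in[OF \<pi>] by (intro projection_near[OF \<pi>]) auto
  then show ?thesis using path(2) by (simp add: dist_commute)
next
  case False
  have "\<delta> \<le> near_bound \<delta> (\<mu> * \<delta> + \<nu>)"
    using constricting_projection_nonneg[OF \<pi>] nonneg by (intro near_bound_ge) auto
  with False show ?thesis by linarith
qed

definition uniqueness_bound :: "real \<Rightarrow> real" where
  "uniqueness_bound \<delta> = near_bound \<delta> \<delta> + near_bound \<delta> (\<mu> * \<delta> + \<nu>)"

lemma projection_coarsely_unique: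
  assumes \<pi>: "constricting_projection \<Gamma> \<delta> A \<pi>" and \<pi>': "constricting_projection \<Gamma> \<delta> A \<pi>'"
  shows "dist (\<pi> x) (\<pi>' x) \<le> uniqueness_bound \<delta>"
proof (cases "dist (\<pi> x) (\<pi> (\<pi>' x)) > \<delta>")
  case True
  obtain a b \<alpha> where path: "(a, b, \<alpha>) \<in> \<Gamma>" "a \<le> b" "\<alpha> a = x" "\<alpha> b = \<pi>' x"
    by (rule joining_path)
  obtain t where t: "t \<in> {a..b}" "dist (\<pi> x) (\<alpha> t) \<le> \<delta>"
    using subpath_meets_balls(1)[OF \<pi> path(1), of a b] path True by auto
  have "dist (\<pi>' (\<alpha> t)) (\<pi> x) \<le> near_bound \<delta> \<delta>"
    using t(2) by (intro projection_near[OF \<pi>'] constricting_projection_in[OF \<pi>])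
      (simp add: dist_commute)
  moreover have "dist (\<pi>' x) (\<pi>' (\<alpha> t)) \<le> near_bound \<delta> (\<mu> * \<delta> + \<nu>)"
    using projection_coarsely_constant_towards_projection[OF \<pi>' path(1) _ t(1)] path(3,4) by simp
  ultimately show ?thesis
    unfolding uniqueness_bound_def
    using dist_triangle[of "\<pi>' x" "\<pi> x" "\<pi>' (\<alpha> t)"] by (simp add: dist_commute)
next
  case False
  have \<delta>: "0 \<le> \<delta>" by (rule constricting_projection_nonneg[OF \<pi>])
  have "dist (\<pi>' x) (\<pi> (\<pi>' x)) \<le> \<delta>"
    by (intro constricting_projection_moves_le[OF \<pi>] constricting_projection_in[OF \<pi>'])
  moreover have "dist (\<pi> x) (\<pi>' x) \<le> dist (\<pi> x) (\<pi> (\<pi>' x)) + dist (\<pi>' x) (\<pi> (\<pi>' x))"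
    by (rule dist_triangle2)
  moreover have "\<delta> \<le> near_bound \<delta> \<delta>" "\<delta> \<le> near_bound \<delta> (\<mu> * \<delta> + \<nu>)"
    using \<delta> nonneg by (auto intro!: near_bound_ge)
  ultimately show ?thesis using False unfolding uniqueness_bound_def by linarith
qed

lemma no_backtracking:
  assumes \<pi>: "constricting_projection \<Gamma> \<delta> A \<pi>"
    and path: "(a, b, \<alpha>) \<in> \<Gamma>" and q: "q \<in> {a..b}"
    and q_near: "dist (\<pi> (\<alpha> a)) (\<pi> (\<alpha> q)) \<le> e" and start_near: "dist (\<alpha> a) (\<pi> (\<alpha> a)) \<le> E"
    and far: "dist (\<pi> (\<alpha> a)) (\<pi> (\<alpha> b)) > \<delta> + e"
  shows "dist (\<alpha> a) (\<alpha> q) \<le> \<mu> * (\<delta> + e + E) + \<nu>"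
proof -
  have "dist (\<pi> (\<alpha> a)) (\<pi> (\<alpha> b)) \<le> dist (\<pi> (\<alpha> a)) (\<pi> (\<alpha> q)) + dist (\<pi> (\<alpha> q)) (\<pi> (\<alpha> b))"
    by (rule dist_triangle)
  then have "dist (\<pi> (\<alpha> q)) (\<pi> (\<alpha> b)) > \<delta>" using far q_near by linarith
  then obtain s where s: "s \<in> {q..b}" "dist (\<pi> (\<alpha> q)) (\<alpha> s) \<le> \<delta>"
    using subpath_meets_balls(1)[OF \<pi> path, of q b] q by auto
  have "dist (\<alpha> a) (\<alpha> s) \<le> \<delta> + e + E"
    using dist_triangle4[of "\<alpha> a" "\<alpha> s" "\<pi> (\<alpha> a)" "\<pi> (\<alpha> q)"] s(2) q_near start_near by linarith
  moreover have "dist (\<alpha> a) (\<alpha> q) \<le> \<mu> * dist (\<alpha> a) (\<alpha> s) + \<nu>"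
    using q s(1) by (intro subpath_diameter_le[OF path]) auto
  ultimately show ?thesis
    using mult_left_mono[OF _ nonneg(1), of "dist (\<alpha> a) (\<alpha> s)"]
    by (meson add_right_mono order_trans)
qed

lemma base_points_near_if_both_projections_far:
  assumes P: "constricting_projection \<Gamma> \<delta> A P" and Q: "constricting_projection \<Gamma> \<delta> B Q"
    and Q_near: "dist (Q y) y' \<le> c" and P_near: "dist (P y) (P y') \<le> d"
    and y_near: "dist y (P y) \<le> E" and Q_far: "dist (Q y) (Q z) > \<delta>"
    and e: "e = \<mu> * (\<delta> + c) + \<nu> + 2 * \<delta> + d" and P_far: "dist (P y) (P z) > \<delta> + e"
  shows "dist y y' \<le> \<mu> * (\<delta> + e + E) + \<nu> + (\<delta> + c)"
proof -
  obtain a b \<alpha> where path: "(a, b, \<alpha>) \<in> \<Gamma>" "a \<le> b" "\<alpha> a = y" "\<alpha> b = z"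
    by (rule joining_path)
  obtain q where q: "q \<in> {a..b}" "dist (Q y) (\<alpha> q) \<le> \<delta>"
    using subpath_meets_balls(1)[OF Q path(1), of a b] path Q_far by auto
  have q_near_y': "dist (\<alpha> q) y' \<le> \<delta> + c"
    using dist_triangle3[of "\<alpha> q" y' "Q y"] q(2) Q_near by linarith
  have "dist (P (\<alpha> q)) (P y') \<le> \<mu> * dist (\<alpha> q) y' + \<nu> + 2 * \<delta>"
    by (rule projection_coarse_lipschitz[OF P])
  moreover have "\<mu> * dist (\<alpha> q) y' \<le> \<mu> * (\<delta> + c)" using q_near_y' nonneg by (intro mult_left_mono)
  ultimately have "dist (P y) (P (\<alpha> q)) \<le> e"
    using dist_triangle2[of "P y" "P (\<alpha> q)" "P y'"] P_near unfolding e by linarith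
  then have "dist y (\<alpha> q) \<le> \<mu> * (\<delta> + e + E) + \<nu>"
    using no_backtracking[OF P path(1) q(1)] path(3,4) y_near P_far by simp
  with q_near_y' show ?thesis using dist_triangle[of y y' "\<alpha> q"] by linarith
qed

lemma quasi_convex_set_near_projection:
  assumes P: "constricting_projection \<Gamma> \<delta> A P" and Y: "quasi_convex_set \<Gamma> \<eta> Y"
    and ends: "y \<in> Y" "y' \<in> Y" and far: "dist (P y) (P y') > \<delta>"
  obtains z where "z \<in> Y" "dist (P y) z < \<delta> + \<eta> + 1"
proof -
  obtain a b \<alpha> where path: "(a, b, \<alpha>) \<in> \<Gamma>" "a \<le> b" "\<alpha> a = y" "\<alpha> b = y'"
    by (rule joining_path)
  obtain s where s: "s \<in> {a..b}" "dist (P y) (\<alpha> s) \<le> \<delta>"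
    using subpath_meets_balls(1)[OF P path(1), of a b] path far by auto
  have "path_image' (a, b, \<alpha>) \<subseteq> nbhd Y \<eta>"
    using Y path ends unfolding quasi_convex_set_def by (auto simp: start_pt_def end_pt_def)
  then have "infdist (\<alpha> s) Y < \<eta> + 1"
    using s(1) by (fastforce simp: path_image'_def nbhd_def)
  then obtain z where z: "z \<in> Y" "dist (\<alpha> s) z < \<eta> + 1"
    using ends(1) by (auto simp: infdist_def cINF_less_iff split: if_splits)
  have "dist (P y) z < \<delta> + \<eta> + 1"
    using dist_triangle[of "P y" z "\<alpha> s"] s(2) z(2) by linarith
  with z(1) show thesis by (rule that)
qed

end

section \<open>Growth rates\<close>

lemma eventually_less_exp_of_growth_rate_less:
  assumes "growth_rate N < ereal m"
  shows "\<forall>\<^sub>F r in at_top. real (N r) < exp (m * r)"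
proof -
  have "\<forall>\<^sub>F r in at_top. ereal (ln (real (N r)) / r) < ereal m"
    using assms unfolding growth_rate_def by (rule Limsup_lessD)
  then show ?thesis
    using eventually_gt_at_top[of 0]
  proof eventually_elim
    case (elim r)
    then have "exp (ln (real (N r))) < exp (m * r)" by (simp add: pos_divide_less_eq)
    then show ?case by (cases "N r = 0") auto
  qed
qed

lemma growth_rate_le_of_eventually_le_exp:
  assumes "\<forall>\<^sub>F r in at_top. 0 < N r" "\<forall>\<^sub>F r in at_top. real (N r) \<le> exp (m * r)"
  shows "growth_rate N \<le> ereal m"
  unfolding growth_rate_def
proof (rule Limsup_bounded)
  show "\<forall>\<^sub>F r in at_top. ereal (ln (real (N r)) / r) \<le> ereal m"
    using assms eventually_gt_at_top[of 0]
  proof eventually_elim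
    case (elim r)
    then have "ln (real (N r)) \<le> ln (exp (m * r))" by (subst ln_le_cancel_iff) auto
    with elim show ?case by (simp add: pos_divide_le_eq)
  qed
qed

lemma growth_rate_le_of_le_shift:
  fixes K :: nat and c :: real
  assumes pos: "\<forall>\<^sub>F r in at_top. 0 < M r" and le: "\<forall>\<^sub>F r in at_top. M r \<le> K * N (r + c)"
  shows "growth_rate M \<le> growth_rate N"
proof (rule dense_ge)
  fix z assume "growth_rate N < z"
  then obtain m where m: "growth_rate N < ereal m" "ereal m < z" by (metis ereal_dense2)
  obtain m' where m': "ereal m < ereal m'" "ereal m' < z" using ereal_dense2[OF m(2)] by blast
  have shift: "LIM r at_top. r + c :> at_top"
    using filterlim_tendsto_add_at_top[OF tendsto_const[of c] filterlim_ident]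
    by (simp add: add.commute)
  have "\<forall>\<^sub>F r in at_top. real (M r) \<le> exp (m' * r)"
    using pos le
      eventually_compose_filterlim[OF eventually_less_exp_of_growth_rate_less[OF m(1)] shift]
      eventually_ge_at_top[of "(ln (real K) + m * c) / (m' - m)"]
  proof eventually_elim
    case (elim r)
    then have K: "0 < K" by (cases K) auto
    have "real (M r) \<le> real K * real (N (r + c))" using elim(2) by (metis of_nat_le_iff of_nat_mult)
    also have "\<dots> \<le> exp (ln (real K)) * exp (m * (r + c))"
      using elim(3) K by (intro mult_mono) auto
    also have "\<dots> = exp (ln (real K) + m * c + m * r)" by (simp add: exp_add algebra_simps)
    also have "ln (real K) + m * c + m * r \<le> m' * r"
      using elim(4) m'(1) by (simp add: pos_divide_le_eq algebra_simps)
    finally show ?case by simp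
  qed
  then have "growth_rate M \<le> ereal m'" by (rule growth_rate_le_of_eventually_le_exp[OF pos])
  with m'(2) show "growth_rate M \<le> z" by simp
qed

section \<open>Cosets\<close>

context group
begin

lemma image_inv_l_coset:
  assumes H: "subgroup H G" and g: "g \<in> carrier G"
  shows "m_inv G ` (g <# H) = H #> inv g"
proof
  show "m_inv G ` (g <# H) \<subseteq> H #> inv g"
    using g H subgroup.m_inv_closed[OF H]
    by (auto simp: l_coset_def r_coset_def inv_mult_group subgroup.mem_carrier)
  show "H #> inv g \<subseteq> m_inv G ` (g <# H)"
  proof
    fix z assume "z \<in> H #> inv g"
    then obtain h where h: "h \<in> H" "z = h \<otimes> inv g" by (auto simp: r_coset_def)
    then have "z = inv (g \<otimes> inv h)"
      using g by (simp add: inv_mult_group subgroup.mem_carrier[OF H])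
    moreover have "g \<otimes> inv h \<in> g <# H"
      using subgroup.m_inv_closed[OF H h(1)] by (auto simp: l_coset_def)
    ultimately show "z \<in> m_inv G ` (g <# H)" by blast
  qed
qed

lemma card_l_cosets_eq_card_r_cosets_inv:
  assumes H: "subgroup H G" and B: "B \<subseteq> carrier G"
  shows "card ((\<lambda>g. g <# H) ` B) = card ((\<lambda>g. H #> g) ` m_inv G ` B)"
proof -
  have "inj_on ((`) (m_inv G)) ((\<lambda>g. g <# H) ` B)"
  proof (rule inj_on_subset[OF inj_on_image_Pow])
    show "inj_on (m_inv G) (carrier G)" by (auto intro!: inj_onI dest: inv_inj[THEN inj_onD])
    show "(\<lambda>g. g <# H) ` B \<subseteq> Pow (carrier G)"
      using B subgroup.subset[OF H] l_coset_subset_G by blast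
  qed
  moreover have "(`) (m_inv G) ` (\<lambda>g. g <# H) ` B = (\<lambda>g. H #> g) ` m_inv G ` B"
    unfolding image_image using B by (intro image_cong refl image_inv_l_coset[OF H]) blast
  ultimately show ?thesis by (metis card_image)
qed

lemma card_le_mult_card_r_cosets:
  assumes H: "subgroup H G" and B: "B \<subseteq> carrier G" "finite B" and F: "finite F"
    and fibre: "\<And>g g' h. g \<in> B \<Longrightarrow> g' \<in> B \<Longrightarrow> h \<in> H \<Longrightarrow> g = h \<otimes> g' \<Longrightarrow> h \<in> F"
  shows "card B \<le> card F * card ((\<lambda>g. H #> g) ` B)"
proof -
  let ?cosets = "(\<lambda>g. H #> g) ` B"
  have fibre_card: "card {g \<in> B. H #> g = S} \<le> card F" if S: "S \<in> ?cosets" for S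
  proof -
    obtain g' where g': "g' \<in> B" "S = H #> g'" using S by blast
    have "{g \<in> B. H #> g = S} \<subseteq> (\<lambda>h. h \<otimes> g') ` F"
    proof
      fix g assume g: "g \<in> {g \<in> B. H #> g = S}"
      then have "g \<in> H #> g'" using g' B by (intro repr_independenceD[OF H]) auto
      then obtain h where "h \<in> H" "g = h \<otimes> g'" by (auto simp: r_coset_def)
      with fibre[of g g' h] g g' show "g \<in> (\<lambda>h. h \<otimes> g') ` F" by blast
    qed
    then show ?thesis by (rule surj_card_le[OF F])
  qed
  have "B = (\<Union>S\<in>?cosets. {g \<in> B. H #> g = S})" by blast
  then have "card B = card (\<Union>S\<in>?cosets. {g \<in> B. H #> g = S})" by (rule arg_cong)
  also have "\<dots> \<le> (\<Sum>S\<in>?cosets. card {g \<in> B. H #> g = S})"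
    using B(2) by (intro card_UN_le) simp
  also have "\<dots> \<le> card F * card ?cosets"
    using sum_bounded_above[of ?cosets, OF fibre_card] by (simp add: mult.commute)
  finally show ?thesis .
qed

lemma r_coset_in_rcosets:
  assumes "H \<subseteq> carrier G" "M \<in> rcosets H" "g \<in> carrier G"
  shows "M #> g \<in> rcosets H"
  using assms by (auto simp: RCOSETS_def coset_mult_assoc)

lemma r_coset_int_pow_add:
  assumes "M \<subseteq> carrier G" "f \<in> carrier G"
  shows "M #> f [^] (k + l :: int) = M #> f [^] k #> f [^] l"
  using assms by (simp add: coset_mult_assoc int_pow_mult)

lemma r_coset_int_pow_fixed:
  assumes M: "M \<subseteq> carrier G" and g: "g \<in> carrier G" and fixed: "M #> g = M"
  shows "M #> g [^] (k :: int) = M"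
proof (induction k rule: int_induct[where k = 0])
  case base
  show ?case using M by simp
next
  case (step1 k)
  then show ?case using r_coset_int_pow_add[OF M g, of k 1] g fixed by (simp add: int_pow_1)
next
  case (step2 k)
  have "M #> g [^] (k - 1) = M #> inv g"
    using r_coset_int_pow_add[OF M g, of k "-1"] step2 g by (simp add: int_pow_neg int_pow_1)
  also have "\<dots> = M #> g #> inv g" using fixed by simp
  also have "\<dots> = M" using M g by (simp add: coset_mult_assoc)
  finally show ?case .
qed

lemma finite_r_coset_int_pow_orbit:
  fixes m :: int
  assumes M: "M \<subseteq> carrier G" and f: "f \<in> carrier G" and m: "m \<noteq> 0" and fixed: "M #> f [^] m = M"
  shows "finite (range (\<lambda>k :: int. M #> f [^] k))"
proof -
  have "range (\<lambda>k :: int. M #> f [^] k) \<subseteq> (\<lambda>k :: int. M #> f [^] k) ` {- \<bar>m\<bar>..\<bar>m\<bar>}"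
  proof (rule image_subsetI)
    fix k :: int
    have "M #> f [^] k = M #> f [^] (m * (k div m)) #> f [^] (k mod m)"
      using r_coset_int_pow_add[OF M f, of "m * (k div m)" "k mod m"] by simp
    also have "M #> f [^] (m * (k div m)) = M"
      using r_coset_int_pow_fixed[OF M _ fixed, of "k div m"] f by (simp add: int_pow_pow)
    finally have "M #> f [^] k = M #> f [^] (k mod m)" .
    moreover have "k mod m \<in> {- \<bar>m\<bar>..\<bar>m\<bar>}" using abs_mod_less[OF m, of k] by auto
    ultimately show "M #> f [^] k \<in> (\<lambda>k :: int. M #> f [^] k) ` {- \<bar>m\<bar>..\<bar>m\<bar>}"
      by (rule image_eqI)
  qed
  then show ?thesis by (rule finite_subset) simp
qed

lemma finite_r_coset_int_pow_orbit_of_recurrence: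
  assumes M: "M \<subseteq> carrier G" and f: "f \<in> carrier G" and C: "finite C"
    and recurrent: "infinite {k :: int. M #> f [^] k \<in> C}"
  shows "finite (range (\<lambda>k :: int. M #> f [^] k))"
proof -
  let ?returns = "{k :: int. M #> f [^] k \<in> C}"
  have "finite ((\<lambda>k. M #> f [^] k) ` ?returns)" by (rule finite_subset[OF _ C]) blast
  then have "\<not> inj_on (\<lambda>k. M #> f [^] k) ?returns"
    using recurrent by (blast dest: finite_imageD)
  then obtain k l :: int where kl: "k \<noteq> l" "M #> f [^] k = M #> f [^] l"
    by (auto simp: inj_on_def)
  have "M #> f [^] (k - l) = M #> f [^] l #> f [^] (- l)"
    using r_coset_int_pow_add[OF M f, of k "- l"] kl(2) by simp
  also have "\<dots> = M" using r_coset_int_pow_add[OF M f, of l "- l"] M by simp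
  finally show ?thesis
    using kl(1) by (intro finite_r_coset_int_pow_orbit[OF M f, of "k - l"]) auto
qed

lemma finite_rcosets_of_recurrence:
  assumes H: "subgroup H G" and f: "f \<in> carrier G" and C: "finite C"
    and recurrent: "\<And>M. M \<in> rcosets H \<Longrightarrow> infinite {k :: int. M #> f [^] k \<in> C}"
  shows "finite (rcosets H)"
proof -
  have rcoset_subset: "M \<subseteq> carrier G" if "M \<in> rcosets H" for M
    using subgroup.rcosets_carrier[OF H is_group that] .
  have orbit: "finite (range (\<lambda>k :: int. M #> f [^] k))" if "M \<in> rcosets H" for M
    by (rule finite_r_coset_int_pow_orbit_of_recurrence[OF rcoset_subset f C recurrent])
      (rule that)+
  have "rcosets H \<subseteq> (\<Union>N\<in>C \<inter> rcosets H. range (\<lambda>k :: int. N #> f [^] k))"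
  proof
    fix M assume coset: "M \<in> rcosets H"
    have M: "M \<subseteq> carrier G" by (rule rcoset_subset[OF coset])
    obtain k :: int where k: "M #> f [^] k \<in> C"
      using infinite_imp_nonempty[OF recurrent[OF coset]] by blast
    moreover have "M #> f [^] k \<in> rcosets H"
      using subgroup.subset[OF H] f by (intro r_coset_in_rcosets coset) auto
    moreover have "M = M #> f [^] k #> f [^] (- k)"
      using M r_coset_int_pow_add[OF M f, of k "- k"] by simp
    ultimately show "M \<in> (\<Union>N\<in>C \<inter> rcosets H. range (\<lambda>k :: int. N #> f [^] k))" by blast
  qed
  then show ?thesis by (rule finite_subset) (use C orbit in auto)
qed

end

section \<open>Proper isometric actions\<close>

definition far_region :: "('x::metric_space \<Rightarrow> 'x) \<Rightarrow> 'x \<Rightarrow> real \<Rightarrow> 'x set" where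
  "far_region \<pi> y D = {z. dist (\<pi> y) (\<pi> z) > D}"

locale proper_isometric_action = group G
  for G :: "('g, 'b) monoid_scheme" (structure) +
  fixes \<phi> :: "'g \<Rightarrow> 'x::metric_space \<Rightarrow> 'x"
  assumes action: "isometric_action G \<phi>"
    and proper: "proper_action G \<phi>"
begin

lemma act_one [simp]: "\<phi> \<one> x = x"
  and act_mult: "g \<in> carrier G \<Longrightarrow> h \<in> carrier G \<Longrightarrow> \<phi> (g \<otimes> h) x = \<phi> g (\<phi> h x)"
  and act_dist [simp]: "g \<in> carrier G \<Longrightarrow> dist (\<phi> g x) (\<phi> g y) = dist x y"
  using action by (auto simp: isometric_action_def)

lemma act_inv [simp]:
  assumes "g \<in> carrier G"
  shows "\<phi> g (\<phi> (inv g) x) = x" "\<phi> (inv g) (\<phi> g x) = x"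
  using assms act_mult[of g "inv g" x] act_mult[of "inv g" g x] by auto

lemma dist_act_left:
  assumes "g \<in> carrier G"
  shows "dist (\<phi> g x) y = dist x (\<phi> (inv g) y)"
  using act_dist[OF assms, of x "\<phi> (inv g) y"] assms by simp

lemma image_eq_of_invariant_set:
  assumes K: "subgroup K G" and A: "invariant_set K \<phi> A" and g: "g \<in> K"
  shows "\<phi> g ` A = A"
proof
  show "\<phi> g ` A \<subseteq> A" using A g by (simp add: invariant_set_def)
  show "A \<subseteq> \<phi> g ` A"
  proof
    fix x assume "x \<in> A"
    then have "\<phi> (inv g) x \<in> A"
      using A subgroup.m_inv_closed[OF K g] by (auto simp: invariant_set_def)
    moreover have "x = \<phi> g (\<phi> (inv g) x)" using subgroup.mem_carrier[OF K g] by simp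
    ultimately show "x \<in> \<phi> g ` A" by blast
  qed
qed

lemma gball_subset_carrier: "gball G \<phi> x r \<subseteq> carrier G"
  by (auto simp: gball_def)

lemma finite_gball: "finite (gball G \<phi> x r)"
  using proper by (simp add: proper_action_def)

lemma one_in_gball: "0 \<le> r \<Longrightarrow> \<one> \<in> gball G \<phi> x r"
  by (simp add: gball_def)

lemma image_inv_gball: "m_inv G ` gball G \<phi> x r = gball G \<phi> x r"
proof -
  have inv_closed: "inv g \<in> gball G \<phi> x r" if "g \<in> gball G \<phi> x r" for g
    using that dist_act_left[of g x x] by (simp add: gball_def dist_commute)
  show ?thesis
  proof
    show "gball G \<phi> x r \<subseteq> m_inv G ` gball G \<phi> x r"
    proof
      fix g assume g: "g \<in> gball G \<phi> x r"
      then have "g = inv (inv g)" by (simp add: gball_def)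
      with inv_closed[OF g] show "g \<in> m_inv G ` gball G \<phi> x r" by blast
    qed
  qed (use inv_closed in blast)
qed

lemma mult_in_gball:
  assumes "u \<in> carrier G" "g \<in> gball G \<phi> x r" "dist x (\<phi> u x) \<le> s"
  shows "u \<otimes> g \<in> gball G \<phi> x (r + s)"
  using assms dist_triangle[of x "\<phi> (u \<otimes> g) x" "\<phi> u x"] by (simp add: gball_def act_mult)

lemma finite_orbit_near: "finite {g \<in> carrier G. dist x (\<phi> g y) \<le> r}"
proof (rule finite_subset[OF _ finite_gball])
  show "{g \<in> carrier G. dist x (\<phi> g y) \<le> r} \<subseteq> gball G \<phi> x (r + dist y x)"
  proof
    fix g assume "g \<in> {g \<in> carrier G. dist x (\<phi> g y) \<le> r}"
    then show "g \<in> gball G \<phi> x (r + dist y x)"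
      using dist_triangle[of x "\<phi> g x" "\<phi> g y"] by (simp add: gball_def)
  qed
qed

lemma exists_displacement_gt:
  assumes "infinite S" "S \<subseteq> carrier G"
  shows "\<exists>g\<in>S. dist x (\<phi> g x) > r"
proof (rule ccontr)
  assume "\<not> ?thesis"
  then have "S \<subseteq> gball G \<phi> x r" using assms(2) by (fastforce simp: gball_def)
  with assms(1) show False using finite_gball finite_subset by blast
qed

lemma r_coset_in_image_orbit_near:
  assumes H: "subgroup H G" and h: "h \<in> H" and g: "g \<in> carrier G"
    and near: "dist (\<phi> h x) (\<phi> g y) \<le> r"
  shows "H #> g \<in> (\<lambda>g. H #> g) ` {g \<in> carrier G. dist x (\<phi> g y) \<le> r}"
proof (rule image_eqI)
  have hG: "h \<in> carrier G" by (rule subgroup.mem_carrier[OF H h])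
  then show "inv h \<otimes> g \<in> {g \<in> carrier G. dist x (\<phi> g y) \<le> r}"
    using near g by (simp add: dist_act_left act_mult)
  show "H #> g = H #> (inv h \<otimes> g)"
    using subgroup.m_inv_closed[OF H h] subgroup.subset[OF H] g
    by (intro repr_independence[OF _ _ H] rcosI) auto
qed

definition self_overlaps :: "'g set \<Rightarrow> 'x set \<Rightarrow> 'g set" where
  "self_overlaps H Z = {h \<in> H. \<phi> h ` Z \<inter> Z \<noteq> {}}"

lemma card_hits_le_mult_card_r_cosets:
  assumes H: "subgroup H G" and Z: "finite (self_overlaps H Z)" and B: "B \<subseteq> carrier G" "finite B"
  shows "card {g \<in> B. \<phi> g x \<in> Z} \<le> card (self_overlaps H Z) * card ((\<lambda>g. H #> g) ` B)"
proof -
  let ?hits = "{g \<in> B. \<phi> g x \<in> Z}"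
  have "card ?hits \<le> card (self_overlaps H Z) * card ((\<lambda>g. H #> g) ` ?hits)"
  proof (rule card_le_mult_card_r_cosets[OF H _ _ Z])
    fix g g' h assume hits: "g \<in> ?hits" "g' \<in> ?hits" and h: "h \<in> H" "g = h \<otimes> g'"
    then have "\<phi> g x = \<phi> h (\<phi> g' x)" using B(1) subgroup.mem_carrier[OF H] by (auto simp: act_mult)
    with hits h(1) show "h \<in> self_overlaps H Z" by (auto simp: self_overlaps_def)
  qed (use B in auto)
  also have "card ((\<lambda>g. H #> g) ` ?hits) \<le> card ((\<lambda>g. H #> g) ` B)"
    using B(2) by (intro card_mono) auto
  finally show ?thesis by simp
qed

lemma card_gball_le_mult_card_hits:
  assumes U: "finite U" "U \<subseteq> carrier G" and cover: "\<forall>z. \<exists>u\<in>U. \<phi> u z \<in> Z"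
    and moves_le: "\<And>u. u \<in> U \<Longrightarrow> dist x (\<phi> u x) \<le> s"
  shows "card (gball G \<phi> x r) \<le> card U * card {g \<in> gball G \<phi> x (r + s). \<phi> g x \<in> Z}"
proof -
  let ?hits = "{g \<in> gball G \<phi> x (r + s). \<phi> g x \<in> Z}"
  let ?part = "\<lambda>u. {g \<in> gball G \<phi> x r. \<phi> (u \<otimes> g) x \<in> Z}"
  have part_card: "card (?part u) \<le> card ?hits" if u: "u \<in> U" for u
  proof (rule card_inj_on_le[of "\<lambda>g. u \<otimes> g"])
    show "inj_on (\<lambda>g. u \<otimes> g) (?part u)"
      by (rule inj_on_subset[OF inj_on_cmult]) (use u U(2) gball_subset_carrier in auto)
    show "(\<lambda>g. u \<otimes> g) ` ?part u \<subseteq> ?hits"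
      using u U(2) mult_in_gball[OF _ _ moves_le[OF u]] by auto
    show "finite ?hits" by (simp add: finite_gball)
  qed
  have "gball G \<phi> x r \<subseteq> (\<Union>u\<in>U. ?part u)"
  proof
    fix g assume g: "g \<in> gball G \<phi> x r"
    obtain u where u: "u \<in> U" "\<phi> u (\<phi> g x) \<in> Z" using cover by blast
    then have "\<phi> (u \<otimes> g) x \<in> Z" using g U(2) by (auto simp: act_mult gball_def)
    with g u(1) show "g \<in> (\<Union>u\<in>U. ?part u)" by blast
  qed
  then have "card (gball G \<phi> x r) \<le> card (\<Union>u\<in>U. ?part u)"
    using U(1) by (intro card_mono) (auto simp: finite_gball)
  also have "\<dots> \<le> (\<Sum>u\<in>U. card (?part u))" by (rule card_UN_le[OF U(1)])
  also have "\<dots> \<le> card U * card ?hits" using sum_bounded_above[of U, OF part_card] by simp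
  finally show ?thesis .
qed

lemma eventually_card_image_gball_pos: "\<forall>\<^sub>F r in at_top. 0 < card (c ` gball G \<phi> x r)"
  using eventually_ge_at_top[of 0]
  by eventually_elim (use one_in_gball finite_gball in \<open>fastforce simp: card_gt_0_iff\<close>)

lemma omega_right_le_omega_G: "omega_right G \<phi> H x \<le> omega_G G \<phi> x"
  unfolding omega_right_def omega_G_def
  by (rule growth_rate_le_of_le_shift[where K = 1 and c = 0, OF eventually_card_image_gball_pos])
    (simp add: card_image_le finite_gball)

lemma omega_G_le_omega_right:
  assumes H: "subgroup H G" and Z: "finite (self_overlaps H Z)"
    and U: "finite U" "U \<subseteq> carrier G" and cover: "\<forall>z. \<exists>u\<in>U. \<phi> u z \<in> Z"
  shows "omega_G G \<phi> x \<le> omega_right G \<phi> H x"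
proof -
  define s where "s = (\<Sum>u\<in>U. dist x (\<phi> u x))"
  have moves_le: "dist x (\<phi> u x) \<le> s" if "u \<in> U" for u
    unfolding s_def using that U(1) by (intro member_le_sum) auto
  define cosets where "cosets r = (\<lambda>g. H #> g) ` gball G \<phi> x r" for r
  have card_le:
    "card (gball G \<phi> x r) \<le> (card U * card (self_overlaps H Z)) * card (cosets (r + s))" for r
  proof -
    have "card (gball G \<phi> x r) \<le> card U * card {g \<in> gball G \<phi> x (r + s). \<phi> g x \<in> Z}"
      by (rule card_gball_le_mult_card_hits[OF U cover moves_le])
    also have "\<dots> \<le> card U * (card (self_overlaps H Z) * card (cosets (r + s)))"
      unfolding cosets_def
      by (intro mult_left_mono card_hits_le_mult_card_r_cosets[OF H Z] gball_subset_carrier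
          finite_gball) simp
    finally show ?thesis by (simp add: mult.assoc)
  qed
  have "\<forall>\<^sub>F r in at_top. 0 < card (gball G \<phi> x r)"
    using eventually_card_image_gball_pos[of id] by simp
  then show ?thesis
    unfolding omega_G_def omega_right_def cosets_def[symmetric]
    by (rule growth_rate_le_of_le_shift) (rule always_eventually, rule allI, rule card_le)
qed

lemma omega_left_eq_omega_right:
  assumes "subgroup H G"
  shows "omega_left G \<phi> H x = omega_right G \<phi> H x"
  using card_l_cosets_eq_card_r_cosets_inv[OF assms gball_subset_carrier]
  by (simp add: omega_left_def omega_right_def image_inv_gball)

definition translate :: "'g \<Rightarrow> ('x \<Rightarrow> 'x) \<Rightarrow> 'x \<Rightarrow> 'x" where
  "translate g \<pi> x = \<phi> g (\<pi> (\<phi> (inv g) x))"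

lemma act_in_far_region_translate_iff:
  assumes "g \<in> carrier G"
  shows "\<phi> g z \<in> far_region (translate g \<pi>) y D \<longleftrightarrow> z \<in> far_region \<pi> (\<phi> (inv g) y) D"
  using assms by (simp add: far_region_def translate_def)

end

section \<open>Actions preserving a path system\<close>

locale path_group = proper_isometric_action G \<phi> + path_space \<Gamma> \<mu> \<nu>
  for G :: "('g, 'b) monoid_scheme" (structure)
    and \<phi> :: "'g \<Rightarrow> 'x::metric_space \<Rightarrow> 'x"
    and \<Gamma> :: "'x path set" and \<mu> \<nu> :: real +
  assumes path_invariant: "g \<in> carrier G \<Longrightarrow> (a, b, \<alpha>) \<in> \<Gamma> \<Longrightarrow> (a, b, \<phi> g \<circ> \<alpha>) \<in> \<Gamma>"
begin

lemma constricting_projection_translate: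
  assumes \<pi>: "constricting_projection \<Gamma> \<delta> A \<pi>" and g: "g \<in> carrier G"
  shows "constricting_projection \<Gamma> \<delta> (\<phi> g ` A) (translate g \<pi>)"
  unfolding constricting_projection_def
proof (intro conjI allI impI ballI)
  show "range (translate g \<pi>) \<subseteq> \<phi> g ` A"
    using constricting_projection_in[OF \<pi>] by (auto simp: translate_def)
  show "dist x (translate g \<pi> x) \<le> \<delta>" if "x \<in> \<phi> g ` A" for x
    using that g constricting_projection_moves_le[OF \<pi>] by (auto simp: translate_def)
next
  fix a b \<alpha>
  assume path: "(a, b, \<alpha>) \<in> \<Gamma>" and far: "dist (translate g \<pi> (\<alpha> a)) (translate g \<pi> (\<alpha> b)) > \<delta>"
  have "(a, b, \<phi> (inv g) \<circ> \<alpha>) \<in> \<Gamma>" using path_invariant path g by simp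
  then have "(\<exists>t\<in>{a..b}. dist (\<pi> (\<phi> (inv g) (\<alpha> a))) (\<phi> (inv g) (\<alpha> t)) \<le> \<delta>) \<and>
    (\<exists>t\<in>{a..b}. dist (\<pi> (\<phi> (inv g) (\<alpha> b))) (\<phi> (inv g) (\<alpha> t)) \<le> \<delta>)"
    using \<pi> far g unfolding constricting_projection_def translate_def by fastforce
  then show "\<exists>t\<in>{a..b}. dist (translate g \<pi> (\<alpha> a)) (\<alpha> t) \<le> \<delta>"
    and "\<exists>t\<in>{a..b}. dist (translate g \<pi> (\<alpha> b)) (\<alpha> t) \<le> \<delta>"
    using g by (auto simp: translate_def dist_act_left)
qed

lemma projection_coarsely_equivariant:
  assumes \<pi>: "constricting_projection \<Gamma> \<delta> A \<pi>" and g: "g \<in> carrier G" "\<phi> g ` A = A"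
  shows "dist (\<pi> (\<phi> g x)) (\<phi> g (\<pi> x)) \<le> uniqueness_bound \<delta>"
proof -
  have "constricting_projection \<Gamma> \<delta> A (translate g \<pi>)"
    using constricting_projection_translate[OF \<pi> g(1)] g(2) by simp
  from projection_coarsely_unique[OF \<pi> this, of "\<phi> g x"] show ?thesis
    using g(1) by (simp add: translate_def)
qed

lemma far_region_cover:
  assumes \<pi>: "constricting_projection \<Gamma> \<delta> A \<pi>" and g: "g \<in> carrier G" "\<phi> g ` A = A"
    and moves_far: "dist (\<pi> y) (\<phi> g (\<pi> y)) > 2 * D + uniqueness_bound \<delta>"
  shows "z \<in> far_region \<pi> y D \<or> \<phi> g z \<in> far_region \<pi> y D"
proof (rule ccontr)
  assume "\<not> ?thesis"
  then have "dist (\<pi> y) (\<pi> z) \<le> D" "dist (\<pi> y) (\<pi> (\<phi> g z)) \<le> D" by (auto simp: far_region_def)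
  moreover have "dist (\<phi> g (\<pi> z)) (\<phi> g (\<pi> y)) = dist (\<pi> y) (\<pi> z)"
    using g(1) by (simp add: dist_commute)
  ultimately show False
    using dist_triangle4[of "\<pi> y" "\<phi> g (\<pi> y)" "\<pi> (\<phi> g z)" "\<phi> g (\<pi> z)"]
      projection_coarsely_equivariant[OF \<pi> g, of z] moves_far by linarith
qed

lemma exists_finite_self_overlaps_far_region:
  assumes P: "constricting_projection \<Gamma> \<delta> A P" and H: "subgroup H G"
    and bdd: "bounded ((\<lambda>h. P (\<phi> h y)) ` H)"
  shows "\<exists>D. finite (self_overlaps H (far_region P y D))"
proof -
  obtain d where d: "\<And>h. h \<in> H \<Longrightarrow> dist (P y) (P (\<phi> h y)) \<le> d"
    using bdd unfolding bounded_any_center[where a = "P y"] by blast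
  have "0 \<le> d" using d[OF subgroup.one_closed[OF H]] by simp
  define E where "E = dist y (P y)"
  define e where "e = \<mu> * (\<delta> + (d + E)) + \<nu> + 2 * \<delta> + d"
  have "d \<le> e"
    using nonneg \<open>0 \<le> d\<close> constricting_projection_nonneg[OF P] by (simp add: e_def E_def)
  have "self_overlaps H (far_region P y (\<delta> + e)) \<subseteq>
      {g \<in> carrier G. dist y (\<phi> g y) \<le> \<mu> * (\<delta> + e + E) + \<nu> + (\<delta> + (d + E))}"
  proof
    fix h assume "h \<in> self_overlaps H (far_region P y (\<delta> + e))"
    then obtain z where h: "h \<in> H" and
      far: "dist (P y) (P z) > \<delta> + e" "dist (P y) (P (\<phi> h z)) > \<delta> + e"
      by (auto simp: self_overlaps_def far_region_def)
    have hG: "h \<in> carrier G" by (rule subgroup.mem_carrier[OF H h])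
    define Q where "Q = translate h P"
    have Q: "constricting_projection \<Gamma> \<delta> (\<phi> h ` A) Q"
      unfolding Q_def by (rule constricting_projection_translate[OF P hG])
    have Qy: "dist (\<phi> h (P y)) (Q y) \<le> d"
      using d[OF subgroup.m_inv_closed[OF H h]] hG by (simp add: Q_def translate_def)
    have "dist (Q y) (\<phi> h y) \<le> d + E"
      using dist_triangle3[of "Q y" "\<phi> h y" "\<phi> h (P y)"] Qy hG by (simp add: E_def dist_commute)
    moreover have "dist (\<phi> h (P y)) (Q (\<phi> h z)) > \<delta> + e"
      using far(1) hG by (simp add: Q_def translate_def)
    then have "dist (Q y) (Q (\<phi> h z)) > \<delta>"
      using dist_triangle[of "\<phi> h (P y)" "Q (\<phi> h z)" "Q y"] Qy \<open>d \<le> e\<close> by linarith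
    ultimately have "dist y (\<phi> h y) \<le> \<mu> * (\<delta> + e + E) + \<nu> + (\<delta> + (d + E))"
      using d[OF h] far(2)
      by (intro base_points_near_if_both_projections_far[OF P Q]) (auto simp: E_def e_def)
    with hG show "h \<in> {g \<in> carrier G. dist y (\<phi> g y) \<le> \<mu> * (\<delta> + e + E) + \<nu> + (\<delta> + (d + E))}"
      by simp
  qed
  then show ?thesis using finite_orbit_near finite_subset by blast
qed

lemma infinite_axis_returns:
  assumes \<pi>: "constricting_projection \<Gamma> \<delta> A \<pi>" and f: "f \<in> carrier G"
    and cobA: "acts_coboundedly (generate G {f}) \<phi> A \<delta>" and c: "c \<in> A"
    and H: "subgroup H G" and Y: "quasi_convex_set \<Gamma> \<eta> Y" "acts_coboundedly H \<phi> Y \<eta>" "y \<in> Y"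
    and w: "w \<in> carrier G" and unbounded: "\<not> bounded (translate w \<pi> ` Y)"
  shows "infinite {k :: int. H #> w #> f [^] k \<in>
    (\<lambda>g. H #> g) ` {g \<in> carrier G. dist y (\<phi> g c) \<le> 2 * \<delta> + 2 * \<eta> + 1}}" (is "infinite ?returns")
proof
  assume fin: "finite ?returns"
  have far: "\<exists>y\<in>Y. dist x (translate w \<pi> y) > r" for x r
    using unbounded unfolding bounded_any_center[where a = x] by (auto simp: not_le)
  obtain R where R: "\<And>k. k \<in> ?returns \<Longrightarrow> dist (\<phi> w c) (\<phi> (w \<otimes> f [^] k) c) \<le> R"
    using finite_imp_bounded[OF finite_imageI[OF fin, of "\<lambda>k. \<phi> (w \<otimes> f [^] k) c"]]
    unfolding bounded_any_center[where a = "\<phi> w c"] by blast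
  obtain y1 where y1: "y1 \<in> Y" "dist (\<phi> w c) (translate w \<pi> y1) > R + \<delta>" using far by blast
  obtain y2 where y2: "y2 \<in> Y" "dist (translate w \<pi> y1) (translate w \<pi> y2) > \<delta>" using far by blast
  obtain z where z: "z \<in> Y" "dist (translate w \<pi> y1) z < \<delta> + \<eta> + 1"
    by (rule quasi_convex_set_near_projection[OF constricting_projection_translate[OF \<pi> w] Y(1)
          y1(1) y2])
  obtain h where h: "h \<in> H" "dist z (\<phi> h y) \<le> \<eta>"
    using Y(2,3) z(1) unfolding acts_coboundedly_def by blast
  obtain k :: int where k: "dist (\<pi> (\<phi> (inv w) y1)) (\<phi> (f [^] k) c) \<le> \<delta>"
    using cobA c constricting_projection_in[OF \<pi>] unfolding acts_coboundedly_def generate_pow[OF f]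
    by blast
  define g where "g = w \<otimes> f [^] k"
  have near: "dist (translate w \<pi> y1) (\<phi> g c) \<le> \<delta>"
    using k w f by (simp add: g_def translate_def act_mult)
  have "dist (\<phi> h y) (\<phi> g c) \<le> 2 * \<delta> + 2 * \<eta> + 1"
    using dist_triangle4[of "\<phi> h y" "\<phi> g c" z "translate w \<pi> y1"] near z(2) h(2)
    by (simp add: dist_commute)
  moreover have "H #> w #> f [^] k = H #> g"
    using subgroup.subset[OF H] w f by (simp add: coset_mult_assoc g_def)
  ultimately have "k \<in> ?returns"
    using r_coset_in_image_orbit_near[OF H h(1), of g] w f by (simp add: g_def)
  with R have "dist (\<phi> w c) (\<phi> g c) \<le> R" by (simp add: g_def)
  with y1(2) near show False
    using dist_triangle2[of "\<phi> w c" "translate w \<pi> y1" "\<phi> g c"] by linarith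
qed

lemma exists_bounded_projection:
  assumes \<pi>: "constricting_projection \<Gamma> \<delta> A \<pi>" and f: "f \<in> carrier G"
    and cobA: "acts_coboundedly (generate G {f}) \<phi> A \<delta>"
    and H: "subgroup H G" and Y: "quasi_convex_set \<Gamma> \<eta> Y" "acts_coboundedly H \<phi> Y \<eta>" "y \<in> Y"
    and index: "infinite (rcosets H)"
  shows "\<exists>w\<in>carrier G. bounded (translate w \<pi> ` Y)"
proof (rule ccontr)
  assume unbounded: "\<not> ?thesis"
  define F where "F = {g \<in> carrier G. dist y (\<phi> g (\<pi> y)) \<le> 2 * \<delta> + 2 * \<eta> + 1}"
  have "finite ((\<lambda>g. H #> g) ` F)" unfolding F_def by (intro finite_imageI finite_orbit_near)
  moreover have "infinite {k :: int. M #> f [^] k \<in> (\<lambda>g. H #> g) ` F}"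
    if coset: "M \<in> rcosets H" for M
  proof -
    obtain w where w: "w \<in> carrier G" "M = H #> w" using coset by (auto simp: RCOSETS_def)
    then have "\<not> bounded (translate w \<pi> ` Y)" using unbounded by blast
    then show ?thesis
      unfolding w(2) F_def
      by (rule infinite_axis_returns[OF \<pi> f cobA constricting_projection_in[OF \<pi>] H Y w(1)])
  qed
  ultimately have "finite (rcosets H)" by (rule finite_rcosets_of_recurrence[OF H f])
  with index show False by contradiction
qed

lemma exists_displacement_gt_in_generate:
  assumes f: "f \<in> carrier G" and order: "\<And>n::nat. n > 0 \<Longrightarrow> f [^] n \<noteq> \<one>"
  shows "\<exists>t\<in>generate G {f}. dist x (\<phi> t x) > r"
proof (rule exists_displacement_gt)
  show "generate G {f} \<subseteq> carrier G" using f by (intro generate_incl) simp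
  have "ord f = 0" using f order by (simp add: ord_eq_0)
  then show "infinite (generate G {f})"
    using infinite_cyclic_subgroup_order[OF f] f by (simp add: carrier_subgroup_generated)
qed

lemma exists_covering_region_with_finite_self_overlaps:
  assumes f: "constricting_element G \<phi> \<Gamma> f" and H: "quasi_convex_subgroup G \<phi> \<Gamma> H"
    and index: "infinite (rcosets H)"
  obtains Z U where "finite (self_overlaps H Z)" "finite U" "U \<subseteq> carrier G" "\<forall>z. \<exists>u\<in>U. \<phi> u z \<in> Z"
proof -
  have fG: "f \<in> carrier G" and order: "\<And>n::nat. n > 0 \<Longrightarrow> f [^] n \<noteq> \<one>"
    using f by (auto simp: constricting_element_def)
  obtain \<delta> A \<pi> where invA: "invariant_set (generate G {f}) \<phi> A"
    and \<pi>: "constricting_projection \<Gamma> \<delta> A \<pi>" and cobA: "acts_coboundedly (generate G {f}) \<phi> A \<delta>"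
    using f by (auto simp: constricting_element_def constricting_set_iff_projection)
  obtain \<eta> Y y where HG: "subgroup H G" and invY: "invariant_set H \<phi> Y" and
    Y: "quasi_convex_set \<Gamma> \<eta> Y" "acts_coboundedly H \<phi> Y \<eta>" "y \<in> Y"
    using H by (auto simp: quasi_convex_subgroup_def)
  obtain w where w: "w \<in> carrier G" and bdd: "bounded (translate w \<pi> ` Y)"
    using exists_bounded_projection[OF \<pi> fG cobA HG Y index] by blast
  have "bounded ((\<lambda>h. translate w \<pi> (\<phi> h y)) ` H)"
    using invY Y(3) by (intro bounded_subset[OF bdd]) (auto simp: invariant_set_def)
  then obtain D where D: "finite (self_overlaps H (far_region (translate w \<pi>) y D))"
    using exists_finite_self_overlaps_far_region[OF constricting_projection_translate[OF \<pi> w] HG]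
    by blast
  define y' where "y' = \<phi> (inv w) y"
  obtain t where t: "t \<in> generate G {f}" "dist (\<pi> y') (\<phi> t (\<pi> y')) > 2 * D + uniqueness_bound \<delta>"
    using exists_displacement_gt_in_generate[OF fG order] by blast
  have gen: "subgroup (generate G {f}) G" using fG by (intro generate_is_subgroup) simp
  have tG: "t \<in> carrier G" by (rule subgroup.mem_carrier[OF gen t(1)])
  have "z \<in> far_region \<pi> y' D \<or> \<phi> t z \<in> far_region \<pi> y' D" for z
    by (rule far_region_cover[OF \<pi> tG image_eq_of_invariant_set[OF gen invA t(1)] t(2)])
  then have cover: "\<forall>z. \<exists>u\<in>{w, w \<otimes> t}. \<phi> u z \<in> far_region (translate w \<pi>) y D"
    using w tG by (simp add: act_mult act_in_far_region_translate_iff y'_def)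
  show thesis by (rule that[OF D _ _ cover]) (use w tG in auto)
qed

end

theorem mainTheorem3:
  fixes G :: "('g, 'b) monoid_scheme"
    and \<phi> :: "'g \<Rightarrow> 'x::metric_space \<Rightarrow> 'x"
    and \<Gamma> :: "'x path set"
    and \<mu> \<nu> :: real
    and H :: "'g set"
    and x0 :: 'x
  assumes "path_system_group G \<phi> \<Gamma> \<mu> \<nu>"
    and "\<exists>g. constricting_element G \<phi> \<Gamma> g"
    and "quasi_convex_subgroup G \<phi> \<Gamma> H"
    and "infinite (rcosets\<^bsub>G\<^esub> H)"
  shows "omega_left G \<phi> H x0 = omega_G G \<phi> x0 \<and> omega_right G \<phi> H x0 = omega_G G \<phi> x0"
proof -
  have action: "isometric_action G \<phi>" "proper_action G \<phi>"
    and paths: "path_system \<mu> \<nu> \<Gamma>"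
      "\<And>g a b \<alpha>. g \<in> carrier G \<Longrightarrow> (a, b, \<alpha>) \<in> \<Gamma> \<Longrightarrow> (a, b, \<phi> g \<circ> \<alpha>) \<in> \<Gamma>"
    using assms(1) unfolding path_system_group_def by blast+
  interpret group G using action(1) by (simp add: isometric_action_def)
  have "path_system \<bar>\<mu>\<bar> \<bar>\<nu>\<bar> \<Gamma>" by (rule path_system_mono[OF paths(1)]) simp_all
  then interpret path_group G \<phi> \<Gamma> "\<bar>\<mu>\<bar>" "\<bar>\<nu>\<bar>"
    using action paths(2) by unfold_locales simp_all
  have H: "subgroup H G" using assms(3) by (simp add: quasi_convex_subgroup_def)
  obtain f where f: "constricting_element G \<phi> \<Gamma> f" using assms(2) by blast
  obtain Z U where Z: "finite (self_overlaps H Z)"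
    and U: "finite U" "U \<subseteq> carrier G" "\<forall>z. \<exists>u\<in>U. \<phi> u z \<in> Z"
    by (rule exists_covering_region_with_finite_self_overlaps[OF f assms(3,4)])
  have "omega_right G \<phi> H x0 = omega_G G \<phi> x0"
    by (intro antisym omega_right_le_omega_G omega_G_le_omega_right[OF H Z U])
  with omega_left_eq_omega_right[OF H] show ?thesis by simp
qed

end
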